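(* Let $A$ and $B$ be two (not necessarily unital) strongly Morita equivalent C*-algebras and let $\{X, \langle\cdot,\cdot\rangle\}$ be a Hilbert $B$-$A$ bimodule with faithful compact right action of $B$. Let $I \subseteq A$ and $J \subseteq B$ be essential norm-closed two-sided ideals. Then every bounded (left) $A$-module operator $T: X \to X$ and every bounded (right) $B$-module operator $T: X \to X$ maps every norm-closed Hilbert $J$-$I$ subbimodule $Y$ of $X$ with compatible faithful compact right action of $J$ into itself, i.e. $T(Y) \subseteq Y$. Consequently, the collection of all Hilbert $J$-$I$ subbimodules of $X$ with compatible faithful compact right action of $J$ is invariant under the action of any bounded left $A$-linear or right $B$-linear operator on $X$ (each member of the collection is mapped into itself), so that this collection does not exclude any bounded one-sided module operator from the set of its preservers.
   Context: Left Hilbert $A$-modules are complete, with $A$-valued inner product $A$-linear in the first variable and conjugate-$A$-linear in the second. A Hilbert module is full if the closed linear hull of its inner product values is the whole C*-algebra. C*-algebras $A$ and $B$ are strongly Morita equivalent if there is a full left Hilbert $A$-module $E$ which is at the same time a full right Hilbert $B$-module, with $\langle x,y\rangle_A z = x\langle y,z\rangle_B$ for all $x,y,z \in E$. A (left-)Hilbert $B$-$A$ bimodule $X$ is a left Hilbert $A$-module together with a right action of $B$ by adjointable operators on $X$ implemented by a $*$-homomorphism $\phi$ from $B$ into the adjointable $A$-linear operators, $x\cdot b := \phi(b)(x)$ (operators on the left module $X$ are composed as operators acting from the right, so that this is a right action). $\mathrm{K}_A(X)$ denotes the C*-algebra of "compact" operators, i.e. the norm-closed linear span of the elementary operators $z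 \mapsto \langle z,x\rangle y$ with $x,y \in X$. The right action is compact if $\phi(B) \subseteq \mathrm{K}_A(X)$, and it is a faithful compact right action if $\phi$ is a $*$-isomorphism of $B$ onto $\mathrm{K}_A(X)$. For a norm-closed two-sided ideal $J \subseteq B$, a compact right action of $J$ is compatible if $\phi(B)\subseteq \mathrm{K}_A(X)$ and $J$ acts as $\phi(J)$, i.e. by restriction of the given $B$-action. A Hilbert $J$-$I$ subbimodule $Y$ of $X$ is a linear subspace $Y\subseteq X$ which, with the inner product and the actions inherited from $X$, is a Hilbert $J$-$I$ bimodule: $IY \subseteq Y$, $Y\cdot J \subseteq Y$, and $\langle y,y'\rangle \in I$ for $y,y'\in Y$. It has compatible faithful compact right action of $J$ if the action of $J$ on $Y$ is the restricted one and it implements a $*$-isomorphism of $J$ onto $\mathrm{K}_I(Y)$. A bounded $A$-module (resp. $B$-module) operator is a bounded linear map $T: X\to X$ with $T(ax)=aT(x)$ for all $a \in A$ (resp. $T(x\cdot b)=T(x)\cdot b$ for all $b\in B$); adjointability is not assumed. An ideal is essential if it has non-zero intersection with every non-zero norm-closed two-sided ideal. *)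

theory Defs
  imports "HOL-Analysis.Analysis"
begin

section \<open>C*-algebras\<close>

class complex_vector = real_vector +
  fixes scaleC :: "complex \<Rightarrow> 'a \<Rightarrow> 'a"  (infixr \<open>*\<^sub>C\<close> 75)
  assumes scaleC_add_right: "c *\<^sub>C (x + y) = c *\<^sub>C x + c *\<^sub>C y"
    and scaleC_add_left: "(c + d) *\<^sub>C x = c *\<^sub>C x + d *\<^sub>C x"
    and scaleC_scaleC: "c *\<^sub>C d *\<^sub>C x = (c * d) *\<^sub>C x"
    and scaleC_of_real: "complex_of_real r *\<^sub>C x = r *\<^sub>R x"

global_interpretation complex_vector: vector_space "scaleC :: complex \<Rightarrow> 'a \<Rightarrow> 'a::complex_vector"
  by unfold_locales
    (simp_all add: scaleC_add_right scaleC_add_left scaleC_scaleC scaleC_of_real[of 1, simplified])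

class complex_normed_vector = complex_vector + real_normed_vector +
  assumes norm_scaleC: "norm (c *\<^sub>C x) = cmod c * norm x"

text \<open>C*-algebras, possibly without unit: \<^class>\<open>real_normed_algebra\<close> does not include a unit, and
  the zero algebra is allowed.\<close>

class cstar_algebra = complex_normed_vector + real_normed_algebra + banach +
  fixes star :: "'a \<Rightarrow> 'a"
  assumes scaleC_mult_left: "(c *\<^sub>C a) * b = c *\<^sub>C (a * b)"
    and scaleC_mult_right: "a * (c *\<^sub>C b) = c *\<^sub>C (a * b)"
    and star_add: "star (a + b) = star a + star b"
    and star_scaleC: "star (c *\<^sub>C a) = cnj c *\<^sub>C star a"
    and star_mult: "star (a * b) = star b * star a"
    and star_star: "star (star a) = a"
    and cstar_identity: "norm (star a * a) = (norm a)\<^sup>2"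

definition csubspace :: "'v::complex_vector set \<Rightarrow> bool" where
  "csubspace = module.subspace scaleC"

definition cspan :: "'v::complex_vector set \<Rightarrow> 'v set" where
  "cspan = module.span scaleC"

definition closed_ideal :: "'a::cstar_algebra set \<Rightarrow> bool" where
  "closed_ideal I \<longleftrightarrow> csubspace I \<and> closed I \<and> (\<forall>x\<in>I. \<forall>a. a * x \<in> I \<and> x * a \<in> I)"

definition essential_ideal :: "'a::cstar_algebra set \<Rightarrow> bool" where
  "essential_ideal I \<longleftrightarrow> closed_ideal I \<and>
     (\<forall>K. closed_ideal K \<and> K \<noteq> {0} \<longrightarrow> I \<inter> K \<noteq> {0})"


section \<open>Hilbert modules\<close>

text \<open>A module is given by a carrier \<open>M\<close> inside a complex vector space, and its coefficient algebra by
  a carrier \<open>I\<close> inside a C*-algebra; \<open>I\<close> will be the whole algebra or a norm-closed ideal. Thus the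
  same notions serve for \<open>X\<close> over \<open>A\<close> and for \<open>Y\<close> over \<open>I\<close>. The norm of a Hilbert module is
  determined by its inner product.\<close>

definition hm_norm :: "('x \<Rightarrow> 'x \<Rightarrow> 'a::cstar_algebra) \<Rightarrow> 'x \<Rightarrow> real" where
  "hm_norm ip x = sqrt (norm (ip x x))"

locale left_hilbert_module =
  fixes I :: "'a::cstar_algebra set"
    and M :: "'x::complex_vector set"
    and act :: "'a \<Rightarrow> 'x \<Rightarrow> 'x"
    and ip :: "'x \<Rightarrow> 'x \<Rightarrow> 'a"
  assumes subspace: "csubspace M"
    and act_closed: "\<lbrakk>a \<in> I; x \<in> M\<rbrakk> \<Longrightarrow> act a x \<in> M"
    and act_add_left: "\<lbrakk>a \<in> I; b \<in> I; x \<in> M\<rbrakk> \<Longrightarrow> act (a + b) x = act a x + act b x"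
    and act_add_right: "\<lbrakk>a \<in> I; x \<in> M; y \<in> M\<rbrakk> \<Longrightarrow> act a (x + y) = act a x + act a y"
    and act_scaleC_left: "\<lbrakk>a \<in> I; x \<in> M\<rbrakk> \<Longrightarrow> act (c *\<^sub>C a) x = c *\<^sub>C act a x"
    and act_scaleC_right: "\<lbrakk>a \<in> I; x \<in> M\<rbrakk> \<Longrightarrow> act a (c *\<^sub>C x) = c *\<^sub>C act a x"
    and act_mult: "\<lbrakk>a \<in> I; b \<in> I; x \<in> M\<rbrakk> \<Longrightarrow> act (a * b) x = act a (act b x)"
    and ip_closed: "\<lbrakk>x \<in> M; y \<in> M\<rbrakk> \<Longrightarrow> ip x y \<in> I"
    and ip_add: "\<lbrakk>x \<in> M; y \<in> M; z \<in> M\<rbrakk> \<Longrightarrow> ip (x + y) z = ip x z + ip y z"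
    and ip_scaleC: "\<lbrakk>x \<in> M; y \<in> M\<rbrakk> \<Longrightarrow> ip (c *\<^sub>C x) y = c *\<^sub>C ip x y"
    and ip_act: "\<lbrakk>a \<in> I; x \<in> M; y \<in> M\<rbrakk> \<Longrightarrow> ip (act a x) y = a * ip x y"
    and ip_star: "\<lbrakk>x \<in> M; y \<in> M\<rbrakk> \<Longrightarrow> ip y x = star (ip x y)"
    and ip_positive: "x \<in> M \<Longrightarrow> \<exists>c\<in>I. ip x x = star c * c"
    and ip_definite: "\<lbrakk>x \<in> M; ip x x = 0\<rbrakk> \<Longrightarrow> x = 0"
    and complete: "Metric_space.mcomplete M (\<lambda>x y. hm_norm ip (x - y))"

text \<open>Right Hilbert modules over the whole C*-algebra \<open>'b\<close>; the inner product is linear in the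
  second variable.\<close>

locale right_hilbert_module =
  fixes M :: "'x::complex_vector set"
    and act :: "'x \<Rightarrow> 'b::cstar_algebra \<Rightarrow> 'x"
    and ip :: "'x \<Rightarrow> 'x \<Rightarrow> 'b"
  assumes subspace: "csubspace M"
    and act_closed: "x \<in> M \<Longrightarrow> act x b \<in> M"
    and act_add_left: "\<lbrakk>x \<in> M; y \<in> M\<rbrakk> \<Longrightarrow> act (x + y) b = act x b + act y b"
    and act_add_right: "x \<in> M \<Longrightarrow> act x (b + d) = act x b + act x d"
    and act_scaleC_left: "x \<in> M \<Longrightarrow> act (c *\<^sub>C x) b = c *\<^sub>C act x b"
    and act_scaleC_right: "x \<in> M \<Longrightarrow> act x (c *\<^sub>C b) = c *\<^sub>C act x b"
    and act_mult: "x \<in> M \<Longrightarrow> act x (b * d) = act (act x b) d"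
    and ip_add: "\<lbrakk>x \<in> M; y \<in> M; z \<in> M\<rbrakk> \<Longrightarrow> ip x (y + z) = ip x y + ip x z"
    and ip_scaleC: "\<lbrakk>x \<in> M; y \<in> M\<rbrakk> \<Longrightarrow> ip x (c *\<^sub>C y) = c *\<^sub>C ip x y"
    and ip_act: "\<lbrakk>x \<in> M; y \<in> M\<rbrakk> \<Longrightarrow> ip x (act y b) = ip x y * b"
    and ip_star: "\<lbrakk>x \<in> M; y \<in> M\<rbrakk> \<Longrightarrow> ip y x = star (ip x y)"
    and ip_positive: "x \<in> M \<Longrightarrow> \<exists>c. ip x x = star c * c"
    and ip_definite: "\<lbrakk>x \<in> M; ip x x = 0\<rbrakk> \<Longrightarrow> x = 0"
    and complete: "Metric_space.mcomplete M (\<lambda>x y. hm_norm ip (x - y))"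

definition full :: "('x \<Rightarrow> 'x \<Rightarrow> 'a::cstar_algebra) \<Rightarrow> bool" where
  "full ip \<longleftrightarrow> closure (cspan {ip x y | x y. True}) = UNIV"

text \<open>The equivalence module \<open>E\<close> lives on the third type. Since strong Morita equivalence only
  occurs as a hypothesis, leaving this type variable free amounts to existential quantification
  over \<open>E\<close>. The two inner products may a priori induce different norms.\<close>

definition strongly_morita_equivalent ::
    "'a::cstar_algebra itself \<Rightarrow> 'b::cstar_algebra itself \<Rightarrow> 'e::complex_vector itself \<Rightarrow> bool" where
  "strongly_morita_equivalent _ _ _ \<longleftrightarrow>
     (\<exists>(lact :: 'a \<Rightarrow> 'e \<Rightarrow> 'e) (ract :: 'e \<Rightarrow> 'b \<Rightarrow> 'e) ipA ipB.
        left_hilbert_module UNIV UNIV lact ipA \<and> full ipA \<and>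
        right_hilbert_module UNIV ract ipB \<and> full ipB \<and>
        (\<forall>x y z. lact (ipA x y) z = ract x (ipB y z)))"


section \<open>Adjointable and compact operators, bimodules\<close>

text \<open>Operators on a carrier \<open>M\<close> are functions that are \<^const>\<open>undefined\<close> off \<open>M\<close>, so that
  they are equal iff they agree on \<open>M\<close>. Boundedness of adjointable operators is automatic.\<close>

definition adjointable_ops ::
    "'a::cstar_algebra set \<Rightarrow> 'x::complex_vector set \<Rightarrow> ('a \<Rightarrow> 'x \<Rightarrow> 'x) \<Rightarrow> ('x \<Rightarrow> 'x \<Rightarrow> 'a)
       \<Rightarrow> ('x \<Rightarrow> 'x) set" where
  "adjointable_ops I M act ip = {T \<in> M \<rightarrow>\<^sub>E M.
     (\<forall>x\<in>M. \<forall>y\<in>M. T (x + y) = T x + T y) \<and>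
     (\<forall>c. \<forall>x\<in>M. T (c *\<^sub>C x) = c *\<^sub>C T x) \<and>
     (\<forall>a\<in>I. \<forall>x\<in>M. T (act a x) = act a (T x)) \<and>
     (\<exists>S\<in>M \<rightarrow> M. \<forall>x\<in>M. \<forall>y\<in>M. ip (T x) y = ip x (S y))}"

text \<open>The linear span of the elementary operators \<open>z \<mapsto> \<langle>z, x\<rangle> y\<close>.\<close>

definition finite_rank_ops ::
    "'x::complex_vector set \<Rightarrow> ('a::cstar_algebra \<Rightarrow> 'x \<Rightarrow> 'x) \<Rightarrow> ('x \<Rightarrow> 'x \<Rightarrow> 'a) \<Rightarrow> ('x \<Rightarrow> 'x) set" where
  "finite_rank_ops M act ip =
     {(\<lambda>z\<in>M. \<Sum>k<n. c k *\<^sub>C act (ip z (x k)) (y k)) | (n::nat) c x y. \<forall>k<n. x k \<in> M \<and> y k \<in> M}"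

text \<open>Closure with respect to the operator norm.\<close>

definition compact_ops ::
    "'a::cstar_algebra set \<Rightarrow> 'x::complex_vector set \<Rightarrow> ('a \<Rightarrow> 'x \<Rightarrow> 'x) \<Rightarrow> ('x \<Rightarrow> 'x \<Rightarrow> 'a)
       \<Rightarrow> ('x \<Rightarrow> 'x) set" where
  "compact_ops I M act ip = {T \<in> adjointable_ops I M act ip.
     \<forall>\<epsilon>>0. \<exists>S\<in>finite_rank_ops M act ip. \<forall>z\<in>M. hm_norm ip (T z - S z) \<le> \<epsilon> * hm_norm ip z}"

text \<open>The right action is \<open>x \<cdot> b = \<phi> b x\<close>; hence multiplication in \<open>J\<close> corresponds to composition
  in reversed order.\<close>

locale hilbert_bimodule = left_hilbert_module I M act ip
  for J :: "'b::cstar_algebra set"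
    and I :: "'a::cstar_algebra set"
    and M :: "'x::complex_vector set"
    and act :: "'a \<Rightarrow> 'x \<Rightarrow> 'x"
    and ip :: "'x \<Rightarrow> 'x \<Rightarrow> 'a"
    and \<phi> :: "'b \<Rightarrow> 'x \<Rightarrow> 'x" +
  assumes \<phi>_adjointable: "b \<in> J \<Longrightarrow> restrict (\<phi> b) M \<in> adjointable_ops I M act ip"
    and \<phi>_add: "\<lbrakk>b \<in> J; d \<in> J; x \<in> M\<rbrakk> \<Longrightarrow> \<phi> (b + d) x = \<phi> b x + \<phi> d x"
    and \<phi>_scaleC: "\<lbrakk>b \<in> J; x \<in> M\<rbrakk> \<Longrightarrow> \<phi> (c *\<^sub>C b) x = c *\<^sub>C \<phi> b x"
    and \<phi>_mult: "\<lbrakk>b \<in> J; d \<in> J; x \<in> M\<rbrakk> \<Longrightarrow> \<phi> (b * d) x = \<phi> d (\<phi> b x)"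
    and \<phi>_star: "\<lbrakk>b \<in> J; x \<in> M; y \<in> M\<rbrakk> \<Longrightarrow> ip (\<phi> b x) y = ip x (\<phi> (star b) y)"

definition compact_right_action ::
    "'b set \<Rightarrow> 'a::cstar_algebra set \<Rightarrow> 'x::complex_vector set \<Rightarrow> ('a \<Rightarrow> 'x \<Rightarrow> 'x)
       \<Rightarrow> ('x \<Rightarrow> 'x \<Rightarrow> 'a) \<Rightarrow> ('b \<Rightarrow> 'x \<Rightarrow> 'x) \<Rightarrow> bool" where
  "compact_right_action J I M act ip \<phi> \<longleftrightarrow> (\<forall>b\<in>J. restrict (\<phi> b) M \<in> compact_ops I M act ip)"

text \<open>The *-homomorphism property is part of \<^locale>\<open>hilbert_bimodule\<close>; a *-isomorphism is a bijective
  *-homomorphism.\<close>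

definition faithful_compact_right_action ::
    "'b set \<Rightarrow> 'a::cstar_algebra set \<Rightarrow> 'x::complex_vector set \<Rightarrow> ('a \<Rightarrow> 'x \<Rightarrow> 'x)
       \<Rightarrow> ('x \<Rightarrow> 'x \<Rightarrow> 'a) \<Rightarrow> ('b \<Rightarrow> 'x \<Rightarrow> 'x) \<Rightarrow> bool" where
  "faithful_compact_right_action J I M act ip \<phi> \<longleftrightarrow>
     bij_betw (\<lambda>b. restrict (\<phi> b) M) J (compact_ops I M act ip)"

text \<open>The Hilbert \<open>J\<close>-\<open>I\<close> subbimodules \<open>Y\<close> of \<open>X = UNIV\<close> with compatible faithful compact right
  action of \<open>J\<close>: all structure on \<open>Y\<close> is the inherited one.\<close>

definition compatible_subbimodules ::
    "'b::cstar_algebra set \<Rightarrow> 'a::cstar_algebra set \<Rightarrow> ('a \<Rightarrow> 'x::complex_vector \<Rightarrow> 'x)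
       \<Rightarrow> ('x \<Rightarrow> 'x \<Rightarrow> 'a) \<Rightarrow> ('b \<Rightarrow> 'x \<Rightarrow> 'x) \<Rightarrow> 'x set set" where
  "compatible_subbimodules J I act ip \<phi> =
     {Y. compact_right_action UNIV UNIV UNIV act ip \<phi> \<and>
         hilbert_bimodule J I Y act ip \<phi> \<and> faithful_compact_right_action J I Y act ip \<phi>}"


section \<open>Bounded one-sided module operators\<close>

definition bounded_clinear :: "('x::complex_normed_vector \<Rightarrow> 'x) \<Rightarrow> bool" where
  "bounded_clinear T \<longleftrightarrow> bounded_linear T \<and> (\<forall>c x. T (c *\<^sub>C x) = c *\<^sub>C T x)"

definition bounded_left_module_ops ::
    "('a \<Rightarrow> 'x::complex_normed_vector \<Rightarrow> 'x) \<Rightarrow> ('x \<Rightarrow> 'x) set" where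
  "bounded_left_module_ops act = {T. bounded_clinear T \<and> (\<forall>a x. T (act a x) = act a (T x))}"

definition bounded_right_module_ops ::
    "('b \<Rightarrow> 'x::complex_normed_vector \<Rightarrow> 'x) \<Rightarrow> ('x \<Rightarrow> 'x) set" where
  "bounded_right_module_ops \<phi> = {T. bounded_clinear T \<and> (\<forall>b x. T (\<phi> b x) = \<phi> b (T x))}"

definition preservers :: "'x::complex_normed_vector set set \<Rightarrow> ('x \<Rightarrow> 'x) set" where
  "preservers \<Y> = {T. bounded_clinear T \<and> (\<forall>Y\<in>\<Y>. T ` Y \<subseteq> Y)}"

end

theory Submission
  imports Defs
begin

text \<open>Every \<open>y\<close> in a Hilbert module \<open>Y\<close> is a limit of elements \<open>\<langle>y, w\<rangle> y\<close> with \<open>w \<in> Y\<close>, because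
  \<open>h = \<langle>y, y\<rangle>\<close> is a limit of elements \<open>h r h\<close>. By surjectivity of \<open>\<phi>\<close> onto the compact operators, the
  elementary operator \<open>z \<mapsto> \<langle>z, w\<rangle> y\<close> is \<open>\<phi> b\<close> on \<open>X\<close> and, if \<open>w, y \<in> Y\<close>, also \<open>\<phi> j\<close> on \<open>Y\<close> with
  \<open>j \<in> J\<close>; faithfulness on \<open>Y\<close> puts \<open>b - j\<close> into the annihilator of the essential ideal \<open>J\<close>, so
  \<open>b = j\<close>. Hence a right module operator \<open>T\<close> maps \<open>\<langle>y, w\<rangle> y\<close> to \<open>\<phi> j (T y) = \<langle>T y, w\<rangle> y\<close>, which lies
  in \<open>A Y \<subseteq> Y\<close>. For a left module operator take \<open>x = \<phi> j y\<close>: then \<open>T (\<langle>x, v\<rangle> x) = \<langle>x, v\<rangle> T x\<close> is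
  \<open>\<phi> b x = \<phi> (j b) y \<in> Y\<close> for some \<open>b \<in> B\<close>, and such elements approximate \<open>T x\<close>.\<close>

section \<open>Self-adjoint elements of C*-algebras\<close>

lemma star_zero: "star (0::'a::cstar_algebra) = 0"
  using star_add[of "0::'a" 0] by simp

lemma star_minus: "star (- a) = - star (a::'a::cstar_algebra)"
  using star_add[of a "- a"] by (simp add: star_zero eq_neg_iff_add_eq_0 add.commute)

lemma star_diff: "star (a - b) = star a - star (b::'a::cstar_algebra)"
  using star_add[of a "- b"] by (simp add: star_minus)

lemma star_scaleR: "star (r *\<^sub>R a) = r *\<^sub>R star (a::'a::cstar_algebra)"
  using star_scaleC[of "complex_of_real r" a] by (simp add: scaleC_of_real)

lemma star_sum: "star (sum f S) = (\<Sum>k\<in>S. star (f k :: 'a::cstar_algebra))"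
  by (induction S rule: infinite_finite_induct) (simp_all add: star_zero star_add)

lemma norm_star: "norm (star a) = norm (a::'a::cstar_algebra)"
proof -
  have le: "norm b \<le> norm (star b)" for b :: 'a
  proof (cases "b = 0")
    case False
    have "norm b * norm b \<le> norm (star b) * norm b"
      using cstar_identity[of b] norm_mult_ineq[of "star b" b] by (simp add: power2_eq_square)
    then show ?thesis using False by simp
  qed simp
  show ?thesis using le[of a] le[of "star a"] by (simp add: star_star)
qed

lemma norm_self_adjoint_square:
  "star a = a \<Longrightarrow> norm (a * a) = (norm (a::'a::cstar_algebra))\<^sup>2"
  using cstar_identity[of a] by simp

lemma bounded_linear_star: "bounded_linear (star :: 'a::cstar_algebra \<Rightarrow> 'a)"
  by (rule bounded_linear_intro[where K = 1]) (simp_all add: star_add star_scaleR norm_star)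

text \<open>Here \<open>1 + q\<close> is the square root of \<open>1 - h\<^sup>2\<close> in the unitization.\<close>

lemma exists_sqrt_one_minus_square:
  fixes h :: "'a::cstar_algebra"
  assumes sa: "star h = h" and small: "norm h \<le> 1/2"
  obtains q where "star q = q" "q * h = h * q" "q + q + q * q = - (h * h)"
proof -
  \<comment> \<open>The equation for \<open>q\<close> is the fixed-point equation of
    \<open>f\<close>. Self-adjointness and commutation with \<open>h\<close> are built into the
    closed set \<open>S\<close>, so the fixed point inherits them; on radius \<open>1/2\<close> the
    map \<open>f\<close> contracts by \<open>1/2\<close>.\<close>
  define S where "S = {q :: 'a. norm q \<le> 1/2 \<and> star q = q \<and> q * h = h * q}"
  define f where "f q = (- 1/2) *\<^sub>R (h * h + q * q)" for q :: 'a
  have "closed S"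
    unfolding S_def
    by (intro closed_Collect_conj closed_Collect_le closed_Collect_eq continuous_intros
        bounded_linear.continuous_on[OF bounded_linear_star])
  then have "complete S" by (simp add: complete_eq_closed)
  moreover have "S \<noteq> {}" by (auto simp: S_def star_zero intro!: exI[of _ 0])
  moreover have "f ` S \<subseteq> S"
  proof
    fix p assume "p \<in> f ` S"
    then obtain q where q: "q \<in> S" and p: "p = f q" by blast
    have "norm (h * h) \<le> 1/2 * (1/2)"
      using norm_mult_ineq[of h h] mult_mono[OF small small] by simp
    moreover have "norm (q * q) \<le> 1/2 * (1/2)"
      using norm_mult_ineq[of q q] mult_mono[of "norm q" "1/2" "norm q" "1/2"] q by (simp add: S_def)
    ultimately have "norm (h * h + q * q) \<le> 1"
      using norm_triangle_ineq[of "h * h" "q * q"] by linarith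
    then have "norm p \<le> 1/2" by (simp add: p f_def)
    moreover have "star p = p"
      using q by (simp add: p f_def S_def star_scaleR star_add star_mult sa star_diff star_minus)
    moreover have "q * q * h = h * (q * q)"
      using q by (simp add: S_def mult.assoc) (simp add: mult.assoc[symmetric])
    then have "p * h = h * p"
      by (simp add: p f_def algebra_simps)
    ultimately show "p \<in> S" by (simp add: S_def)
  qed
  moreover have "dist (f p) (f q) \<le> 1/2 * dist p q" if "p \<in> S" "q \<in> S" for p q
  proof -
    \<comment> \<open>This splitting holds even if \<open>p\<close> and \<open>q\<close> do not
      commute.\<close>
    have "f p - f q = (- 1/2) *\<^sub>R (p * (p - q) + (p - q) * q)"
      by (simp add: f_def algebra_simps)
    then have "norm (f p - f q) = 1/2 * norm (p * (p - q) + (p - q) * q)" by simp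
    also have "\<dots> \<le> 1/2 * (norm p * norm (p - q) + norm (p - q) * norm q)"
      by (intro mult_left_mono order.trans[OF norm_triangle_ineq] add_mono norm_mult_ineq) simp
    also have "\<dots> \<le> 1/2 * (1/2 * norm (p - q) + norm (p - q) * (1/2))"
      using that by (intro mult_left_mono add_mono mult_right_mono) (simp_all add: S_def)
    finally show ?thesis by (simp add: dist_norm)
  qed
  ultimately have "\<exists>!q\<in>S. f q = q"
    by (intro Banach_fix[where c = "1/2"]) auto
  then obtain q where q: "q \<in> S" "f q = q" by blast
  have "q + q = 2 *\<^sub>R f q" by (simp add: q(2) scaleR_2)
  also have "\<dots> = - (h * h) - q * q" by (simp add: f_def)
  finally have "q + q + q * q = - (h * h)" by simp
  then show ?thesis using q by (intro that[of q]) (simp_all add: S_def)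
qed

text \<open>With \<open>1 + q\<close> as above, \<open>u = (1 + q) \<plusminus> \<i>h\<close> is unitary, so left multiplication by \<open>1 + q\<close>
  is a contraction, and \<open>1 - h\<^sup>2 = (1 + q)\<^sup>2\<close>.\<close>

lemma norm_diff_square_mult_le:
  fixes h x :: "'a::cstar_algebra"
  assumes sa: "star h = h" and small: "norm h \<le> 1/2"
  shows "norm (x - h * h * x) \<le> norm x"
proof -
  obtain q where q: "star q = q" "q * h = h * q" "q + q + q * q = - (h * h)"
    using exists_sqrt_one_minus_square[OF sa small] .
  \<comment> \<open>\<open>c\<close> covers the imaginary unit and its negative. For lack of a unit
    in the algebra, \<open>1 + q + c h\<close> appears only applied to some \<open>x\<close>; the
    C*-identity turns \<open>star u * u = star x * x\<close> into equality of norms.\<close>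
  have unitary: "norm (x + q * x + c *\<^sub>C (h * x)) = norm x"
    if c: "cnj c * c = 1" "cnj c = - c" for c and x :: 'a
  proof -
    define u where "u = x + q * x + c *\<^sub>C (h * x)"
    have cc: "c * c = - 1" using c by (metis minus_mult_left minus_minus)
    have "star u * u = star x * x + star x * ((q + q + q * q) + h * h) * x
        + c *\<^sub>C (star x * (q * h - h * q) * x)"
      by (simp add: u_def star_add star_mult star_scaleC sa q(1) c(2) algebra_simps
          scaleC_mult_left scaleC_mult_right scaleC_scaleC cc complex_vector.scale_right_diff_distrib
          complex_vector.scale_right_distrib)
    also have "\<dots> = star x * x" using q by simp
    finally have "(norm u)\<^sup>2 = (norm x)\<^sup>2" by (metis cstar_identity)
    then show ?thesis by (simp add: u_def)
  qed
  have contr: "norm (x + q * x) \<le> norm x" for x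
  proof -
    have "2 *\<^sub>R (x + q * x) = (x + q * x + \<i> *\<^sub>C (h * x)) + (x + q * x + (- \<i>) *\<^sub>C (h * x))"
      by (simp add: scaleR_2)
    then have "norm (2 *\<^sub>R (x + q * x)) \<le> norm x + norm x"
      using norm_triangle_ineq[of "x + q * x + \<i> *\<^sub>C (h * x)" "x + q * x + (- \<i>) *\<^sub>C (h * x)"]
        unitary[of \<i> x] unitary[of "- \<i>" x] by simp
    then show ?thesis by simp
  qed
  have "x - h * h * x = x + (q + q + q * q) * x" by (simp add: q(3))
  also have "\<dots> = (x + q * x) + q * (x + q * x)" by (simp add: algebra_simps)
  finally show ?thesis using contr[of "x + q * x"] contr[of x] by (metis order.trans)
qed

text \<open>The operator \<open>1 - hr\<close> is the Cesaro mean \<open>(1/n) (\<Sum>k<n. (1 - h\<^sup>2)\<^sup>k)\<close>, whose product with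
  \<open>h\<^sup>2\<close> telescopes.\<close>

lemma exists_cesaro_mean:
  fixes h :: "'a::cstar_algebra"
  assumes sa: "star h = h" and small: "norm h \<le> 1/2" and n: "n > 0"
    and I: "closed_ideal I" and h: "h \<in> I"
  obtains r where "r \<in> I" "star r = r" "r * h = h * r"
    "\<And>x. norm (x - h * r * x) \<le> norm x"
    "\<And>x. norm (h * h * (x - h * r * x)) \<le> 2 / real n * norm x"
proof -
  define S where "S x = x - h * h * x" for x
  have sub: "csubspace I" and ideal: "\<And>x a. x \<in> I \<Longrightarrow> a * x \<in> I"
    using I by (auto simp: closed_ideal_def)
  note sub' = sub[unfolded csubspace_def]
  have "\<exists>t. t \<in> I \<and> star t = t \<and> t * h = h * t \<and> (\<forall>x. (S ^^ k) x = x - h * t * x)" for k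
  proof (induction k)
    case 0
    then show ?case
      using complex_vector.subspace_0[OF sub'] by (intro exI[of _ 0]) (simp add: star_zero)
  next
    case (Suc k)
    then obtain t where t: "t \<in> I" "star t = t" "t * h = h * t" "\<And>x. (S ^^ k) x = x - h * t * x"
      by blast
    have S_Suc: "(S ^^ Suc k) x = S (x - h * t * x)" for x
      by (simp add: t(4))
    have comm: "t * (h * y) = h * (t * y)" for y
      using t(3) by (metis mult.assoc)
    show ?case
    proof (intro exI conjI allI)
      \<comment> \<open>The witness comes from
        \<open>(1 - h * h) * (1 - h * t) = 1 - h * (t + h - h * h * t)\<close>.\<close>
      show "t + h - h * h * t \<in> I"
        by (intro complex_vector.subspace_diff[OF sub'] complex_vector.subspace_add[OF sub'] t h ideal)
    qed (simp_all only: S_Suc, simp_all add: S_def t star_add star_diff star_mult sa algebra_simps comm)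
  qed
  then obtain t where t: "\<And>k. t k \<in> I" "\<And>k. star (t k) = t k" "\<And>k. t k * h = h * t k"
    and S_pow: "\<And>k x. (S ^^ k) x = x - h * t k * x"
    by metis
  have S_norm: "norm ((S ^^ k) x) \<le> norm x" for k x
    by (induction k) (auto simp: S_def intro: order.trans[OF norm_diff_square_mult_le[OF sa small]])
  define r where "r = (1 / real n) *\<^sub>R (\<Sum>k<n. t k)"
  have mean: "x - h * r * x = (1 / real n) *\<^sub>R (\<Sum>k<n. (S ^^ k) x)" for x
    using n by (simp add: S_pow r_def sum_subtractf sum_distrib_left sum_distrib_right
        scaleR_right_diff_distrib sum_constant_scaleR)
  show ?thesis
  proof
    show "r \<in> I"
      unfolding r_def scaleC_of_real[symmetric]
      by (intro complex_vector.subspace_scale[OF sub'] complex_vector.subspace_sum[OF sub'] t)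
    show "star r = r" by (simp add: r_def star_scaleR star_sum t)
    show "r * h = h * r" by (simp add: r_def sum_distrib_left sum_distrib_right t)
    show "norm (x - h * r * x) \<le> norm x" for x
    proof -
      have "norm (\<Sum>k<n. (S ^^ k) x) \<le> real n * norm x"
        using sum_norm_bound[of "{..<n}" "\<lambda>k. (S ^^ k) x" "norm x"] S_norm by simp
      then show ?thesis unfolding mean using n by (simp add: field_simps)
    qed
    show "norm (h * h * (x - h * r * x)) \<le> 2 / real n * norm x" for x
    proof -
      have "h * h * (\<Sum>k<n. (S ^^ k) x) = (\<Sum>k<n. (S ^^ k) x - (S ^^ Suc k) x)"
        by (simp add: sum_distrib_left S_def)
      also have "\<dots> = x - (S ^^ n) x"
        using sum_lessThan_telescope'[of "\<lambda>k. (S ^^ k) x" n] by simp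
      \<comment> \<open>Only the two end terms survive, whence the constant
        \<open>2\<close>.\<close>
      finally have "norm (h * h * (\<Sum>k<n. (S ^^ k) x)) \<le> 2 * norm x"
        using norm_triangle_ineq4[of x "(S ^^ n) x"] S_norm[of n x] by simp
      then show ?thesis unfolding mean using n by (simp add: field_simps)
    qed
  qed
qed

text \<open>With \<open>b = h - h * r * h\<close>, the C*-identity is used twice to descend from the
  Cesaro estimate for \<open>h * h * b\<close>, first to \<open>h * b\<close> and then to
  \<open>b\<close>.\<close>

lemma exists_approximate_quasi_inverse_small:
  fixes h :: "'a::cstar_algebra"
  assumes sa: "star h = h" and small: "norm h \<le> 1/2" and e: "e > 0"
    and I: "closed_ideal I" and h: "h \<in> I"
  obtains r where "r \<in> I" "star r = r" "r * h = h * r"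
    "\<And>x. norm (x - h * r * x) \<le> norm x" "norm (h - h * r * h) < e"
proof -
  \<comment> \<open>Each of the two descents takes a square root, so the final bound is on
    \<open>norm b ^ 4\<close>.\<close>
  obtain n :: nat where n: "n > 0" "1 / real n < e ^ 4"
    using reals_Archimedean[of "e ^ 4"] e by (auto simp: inverse_eq_divide simp flip: of_nat_Suc)
  obtain r where r: "r \<in> I" "star r = r" "r * h = h * r"
    "\<And>x. norm (x - h * r * x) \<le> norm x"
    "\<And>x. norm (h * h * (x - h * r * x)) \<le> 2 / real n * norm x"
    using exists_cesaro_mean[OF sa small n(1) I h] by blast
  have comm: "r * (h * y) = h * (r * y)" for y
    using r(3) by (metis mult.assoc)
  define b where "b = h - h * r * h"
  have b_sa: "star b = b"
    by (simp add: b_def star_diff star_mult sa r mult.assoc)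
  have b_norm: "norm b \<le> 1/2" using r(4)[of h] small by (simp add: b_def)
  have bh: "b * h = h * b" by (simp add: b_def algebra_simps comm)
  \<comment> \<open>This exhibits \<open>b * b\<close> as the contraction \<open>1 - h * r\<close>
    applied to \<open>h * b\<close>.\<close>
  have br: "b * b = h * b - h * r * (h * b)"
  proof -
    have rb: "b * r = r * b" by (simp add: b_def left_diff_distrib right_diff_distrib mult.assoc comm r(3))
    have "b * b = b * h - b * (h * (r * h))" by (subst (2) b_def) (simp add: right_diff_distrib mult.assoc)
    also have "b * (h * (r * h)) = h * (b * r) * h" by (simp add: bh mult.assoc[symmetric])
    also have "\<dots> = h * r * (h * b)" by (simp add: rb bh mult.assoc)
    finally show ?thesis by (simp add: bh)
  qed
  have "(norm (h * b))\<^sup>2 = norm (b * (h * h * b))"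
    using cstar_identity[of "h * b"] by (simp add: star_mult sa b_sa mult.assoc)
  also have "\<dots> \<le> norm b * norm (h * h * b)" by (rule norm_mult_ineq)
  also have "\<dots> \<le> 1/2 * (2 / real n * norm h)"
    using r(5)[of h] b_norm by (intro mult_mono) (simp_all add: b_def)
  also have "\<dots> \<le> 1 / real n" using small n by (simp add: field_simps)
  finally have hb: "(norm (h * b))\<^sup>2 \<le> 1 / real n" .
  have "(norm b)\<^sup>2 \<le> norm (h * b)"
    using r(4)[of "h * b"] norm_self_adjoint_square[OF b_sa] by (simp add: br)
  then have "((norm b)\<^sup>2)\<^sup>2 \<le> (norm (h * b))\<^sup>2" by (rule power_mono) simp
  then have "norm b ^ 4 < e ^ 4" using hb n(2) by simp
  then have "norm b < e" using power_less_imp_less_base[of "norm b" 4 e] e by simp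
  then show ?thesis using that r(1-4) unfolding b_def by blast
qed

text \<open>Scaling \<open>h\<close> by \<open>c\<close> reduces to the small case, and
  \<open>c\<close> is then absorbed into \<open>r\<close>. Membership of \<open>r\<close> in
  \<open>I\<close> lets it act on modules with coefficients in \<open>I\<close>.\<close>

lemma exists_approximate_quasi_inverse:
  fixes h :: "'a::cstar_algebra"
  assumes sa: "star h = h" and e: "e > 0" and I: "closed_ideal I" and h: "h \<in> I"
  obtains r where "r \<in> I" "star r = r" "r * h = h * r"
    "\<And>x. norm (x - h * r * x) \<le> norm x" "norm (h - h * r * h) < e"
proof -
  \<comment> \<open>The summand \<open>1\<close> keeps the denominator positive when
    \<open>h = 0\<close>.\<close>
  define c where "c = 1 / (2 * (norm h + 1))"
  have c: "c > 0" by (simp add: c_def add_nonneg_pos)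
  have sub: "complex_vector.subspace I"
    using I by (auto simp: closed_ideal_def csubspace_def)
  have scale: "s *\<^sub>R x \<in> I" if "x \<in> I" for s x
    using complex_vector.subspace_scale[OF sub that, of "complex_of_real s"]
    by (simp add: scaleC_of_real)
  have "norm h / (2 * (norm h + 1)) \<le> 1/2"
    by (subst pos_divide_le_eq) (simp_all add: add_nonneg_pos)
  then have small: "norm (c *\<^sub>R h) \<le> 1/2"
    using c by (simp add: c_def)
  obtain r where r: "r \<in> I" "star r = r" "r * (c *\<^sub>R h) = (c *\<^sub>R h) * r"
    "\<And>x. norm (x - (c *\<^sub>R h) * r * x) \<le> norm x"
    "norm (c *\<^sub>R h - (c *\<^sub>R h) * r * (c *\<^sub>R h)) < c * e"
    using exists_approximate_quasi_inverse_small[OF _ small _ I scale[OF h], of "c * e"] c e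
    by (auto simp: star_scaleR sa)
  show ?thesis
  proof
    show "c *\<^sub>R r \<in> I" by (intro scale r)
    show "star (c *\<^sub>R r) = c *\<^sub>R r" by (simp add: star_scaleR r)
    show "c *\<^sub>R r * h = h * c *\<^sub>R r" using r(3) by simp
    show "norm (x - h * c *\<^sub>R r * x) \<le> norm x" for x using r(4)[of x] by simp
    have "c *\<^sub>R (h - h * c *\<^sub>R r * h) = c *\<^sub>R h - (c *\<^sub>R h) * r * (c *\<^sub>R h)"
      by (simp add: algebra_simps)
    then have "c * norm (h - h * c *\<^sub>R r * h) < c * e"
      using r(5) c by (metis abs_of_pos norm_scaleR)
    then show "norm (h - h * c *\<^sub>R r * h) < e" using c by simp
  qed
qed

text \<open>The right annihilator \<open>K\<close> of \<open>J\<close> is a closed two-sided ideal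
  meeting \<open>J\<close> only in \<open>0\<close>, so essentiality makes it trivial; it contains
  \<open>b - d\<close>.\<close>

lemma essential_ideal_cancel:
  fixes b d :: "'b::cstar_algebra"
  assumes J: "essential_ideal J" and eq: "\<And>k. k \<in> J \<Longrightarrow> k * b = k * d"
  shows "b = d"
proof -
  define K where "K = {x. \<forall>k\<in>J. k * x = 0}"
  have J_ideal: "\<And>x a. x \<in> J \<Longrightarrow> a * x \<in> J \<and> x * a \<in> J" and J0: "0 \<in> J"
    using J complex_vector.subspace_0[of J]
    by (auto simp: essential_ideal_def closed_ideal_def csubspace_def)
  have "closed_ideal K"
    unfolding closed_ideal_def
  proof (intro conjI ballI allI)
    show "csubspace K"
      unfolding csubspace_def
      by (rule complex_vector.subspaceI)
        (auto simp: K_def distrib_left scaleC_mult_right)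
    have "K = (\<Inter>k\<in>J. {x. k * x = 0})" by (auto simp: K_def)
    then show "closed K"
      by (auto intro!: closed_INT closed_Collect_eq continuous_intros)
    show "a * x \<in> K" if "x \<in> K" for a x
      using that J_ideal by (auto simp: K_def simp flip: mult.assoc)
    show "x * a \<in> K" if "x \<in> K" for a x
      using that by (auto simp: K_def simp flip: mult.assoc)
  qed
  moreover have "J \<inter> K = {0}"
  proof -
    have "x = 0" if x: "x \<in> J" "x \<in> K" for x
    proof -
      \<comment> \<open>The factor \<open>x * star x\<close> lies in \<open>J\<close> because
        \<open>x\<close> does, and so it kills \<open>x\<close>, which lies in
        \<open>K\<close>.\<close>
      have "x * star x * x = 0" using x J_ideal by (simp add: K_def)
      then have "(star x * x) * (star x * x) = 0" by (simp add: mult.assoc)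
      then have "norm (star x * x) = 0"
        using norm_self_adjoint_square[of "star x * x"] by (simp add: star_mult star_star)
      then show ?thesis by (simp add: cstar_identity)
    qed
    then show ?thesis using J0 by (auto simp: K_def)
  qed
  ultimately have "K = {0}" using J by (auto simp: essential_ideal_def)
  moreover have "b - d \<in> K" using eq by (simp add: K_def right_diff_distrib)
  ultimately show ?thesis by simp
qed


section \<open>Hilbert modules\<close>

context left_hilbert_module
begin

section \<open>Elementary operators and approximation in Hilbert modules\<close>

lemma diff_closed: "\<lbrakk>x \<in> M; y \<in> M\<rbrakk> \<Longrightarrow> x - y \<in> M"
  using subspace complex_vector.subspace_diff by (auto simp: csubspace_def)

lemma ip_diff: "\<lbrakk>x \<in> M; y \<in> M; z \<in> M\<rbrakk> \<Longrightarrow> ip (x - y) z = ip x z - ip y z"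
  using ip_add[of "x - y" y z] by (simp add: diff_closed)

lemma ip_act_right: "\<lbrakk>a \<in> I; x \<in> M; y \<in> M\<rbrakk> \<Longrightarrow> ip x (act a y) = ip x y * star a"
  using ip_star[of "act a y" x] ip_star[of y x] by (simp add: act_closed ip_act star_mult)

lemma elementary_op_compact:
  assumes "x \<in> M" "y \<in> M"
  shows "(\<lambda>z\<in>M. act (ip z x) y) \<in> compact_ops I M act ip"
proof -
  have "(\<lambda>z\<in>M. act (ip z x) y) \<in> adjointable_ops I M act ip"
    unfolding adjointable_ops_def
  proof (intro CollectI conjI ballI allI)
    \<comment> \<open>The adjoint is the elementary operator with \<open>x\<close> and
      \<open>y\<close> exchanged.\<close>
    show "\<exists>S\<in>M \<rightarrow> M. \<forall>u\<in>M. \<forall>v\<in>M. ip ((\<lambda>z\<in>M. act (ip z x) y) u) v = ip u (S v)"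
      using assms
      by (intro bexI[of _ "\<lambda>v. act (ip v y) x"])
        (auto simp: act_closed ip_closed ip_act ip_act_right ip_star[symmetric])
  qed (use assms subspace in \<open>auto simp: act_closed ip_closed ip_add ip_scaleC ip_act act_add_left
      act_scaleC_left act_mult csubspace_def complex_vector.subspace_add complex_vector.subspace_scale\<close>)
  moreover have "(\<lambda>z\<in>M. act (ip z x) y) \<in> finite_rank_ops M act ip"
    unfolding finite_rank_ops_def using assms
    by (intro CollectI exI[of _ "1::nat"] exI[of _ "\<lambda>_. 1::complex"] exI[of _ "\<lambda>_. x"] exI[of _ "\<lambda>_. y"])
      (simp add: complex_vector.scale_one)
  moreover have "hm_norm ip 0 = 0"
    using complex_vector.subspace_0[OF subspace[unfolded csubspace_def]]
      ip_diff[of 0 0 0] by (simp add: hm_norm_def)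
  ultimately show ?thesis
    unfolding compact_ops_def
    by (auto simp: hm_norm_def intro!: bexI[of _ "\<lambda>z\<in>M. act (ip z x) y"])
qed

text \<open>Take \<open>w = r y\<close> for an approximate quasi-inverse \<open>r\<close> of
  \<open>h = ip y y\<close>. The error \<open>v = (1 - h r) y\<close> satisfies
  \<open>ip v v = (1 - h r) (h - h r h)\<close>, a contraction applied to a small element; the
  tolerance is \<open>e\<^sup>2\<close> because \<open>hm_norm\<close> is a square root.\<close>

lemma exists_elementary_op_near:
  assumes I: "closed_ideal I" and y: "y \<in> M" and e: "e > 0"
  obtains w where "w \<in> M" "hm_norm ip (y - act (ip y w) y) < e"
proof -
  define h where "h = ip y y"
  have h: "h \<in> I" "star h = h" using y by (auto simp: h_def ip_closed ip_star[symmetric])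
  obtain r where r: "r \<in> I" "star r = r" "r * h = h * r"
    "\<And>x. norm (x - h * r * x) \<le> norm x" "norm (h - h * r * h) < e\<^sup>2"
    using exists_approximate_quasi_inverse[OF h(2) _ I h(1), of "e\<^sup>2"] e by auto
  have hr: "h * r \<in> I" using I r(1) by (simp add: closed_ideal_def)
  define v where "v = y - act (h * r) y"
  have v: "v \<in> M" by (simp add: v_def y hr act_closed diff_closed)
  have vy: "ip v y = h - h * r * h"
    by (simp add: v_def ip_diff y hr act_closed ip_act h_def[symmetric])
  then have "ip y v = h - h * r * h"
    using ip_star[OF v y] by (simp add: star_diff star_mult h r mult.assoc)
  then have "ip v v = (h - h * r * h) - h * r * (h - h * r * h)"
    using v by (subst (1) v_def) (simp add: ip_diff y hr act_closed ip_act)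
  then have "norm (ip v v) < e\<^sup>2" using r(4)[of "h - h * r * h"] r(5) by simp
  then have "hm_norm ip v < e"
    unfolding hm_norm_def using e real_sqrt_less_mono by fastforce
  moreover have "ip y (act r y) = h * r" by (simp add: ip_act_right r y h_def)
  ultimately show ?thesis using that[of "act r y"] r y by (simp add: v_def act_closed)
qed

lemma norm_act_le:
  assumes a: "a \<in> I" and x: "x \<in> M"
  shows "hm_norm ip (act a x) \<le> norm a * hm_norm ip x"
proof -
  have "ip (act a x) (act a x) = a * (ip x x * star a)"
    using a x by (simp add: ip_act ip_act_right act_closed mult.assoc)
  also have "norm \<dots> \<le> norm a * (norm (ip x x) * norm (star a))"
    by (intro order.trans[OF norm_mult_ineq] mult_left_mono norm_mult_ineq) simp
  also have "\<dots> = (norm a)\<^sup>2 * norm (ip x x)" by (simp add: norm_star power2_eq_square)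
  finally have "sqrt (norm (ip (act a x) (act a x))) \<le> sqrt ((norm a)\<^sup>2 * norm (ip x x))"
    by (rule real_sqrt_le_mono)
  then show ?thesis by (simp add: hm_norm_def real_sqrt_mult)
qed

end

section \<open>Closed carriers and density arguments\<close>

lemma complete_if_mcomplete:
  fixes M :: "'x::metric_space set"
  assumes "Metric_space.mcomplete M dist"
  shows "complete M"
proof -
  interpret Metric_space M dist
    by unfold_locales (simp_all add: dist_commute dist_triangle)
  show ?thesis
    unfolding complete_def
  proof (intro allI impI)
    fix f :: "nat \<Rightarrow> 'x" assume f: "(\<forall>n. f n \<in> M) \<and> Cauchy f"
    then have "MCauchy f" by (auto simp: MCauchy_def Cauchy_def)
    then obtain l where "limitin mtopology f l sequentially"
      using assms by (auto simp: mcomplete_def)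
    then show "\<exists>l\<in>M. f \<longlonglongrightarrow> l"
      by (auto simp: limitin_metric tendsto_iff elim!: eventually_mono)
  qed
qed

text \<open>Identifying the norm of the type with the module norm makes \<open>closure\<close> and
  \<open>closed\<close> refer to the module topology.\<close>

locale normed_left_hilbert_module = left_hilbert_module I M act ip
  for I :: "'a::cstar_algebra set"
    and M :: "'x::complex_normed_vector set"
    and act ip +
  assumes norm_eq: "norm x = hm_norm ip x"
    and coefficients: "closed_ideal I"
begin

lemma closed_carrier: "closed M"
proof -
  have "(\<lambda>x y. hm_norm ip (x - y)) = dist"
    by (simp add: fun_eq_iff dist_norm norm_eq)
  then show ?thesis
    using complete complete_if_mcomplete[of M] complete_imp_closed by simp
qed

lemma mem_closure_elementary_ops:
  assumes y: "y \<in> M"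
  shows "y \<in> closure {act (ip y w) y | w. w \<in> M}"
  unfolding closure_approachable
proof (intro allI impI)
  fix e :: real assume "e > 0"
  then obtain w where w: "w \<in> M" "hm_norm ip (y - act (ip y w) y) < e"
    using exists_elementary_op_near[OF coefficients y] by blast
  then show "\<exists>z\<in>{act (ip y w) y | w. w \<in> M}. dist z y < e"
    by (auto simp: dist_norm norm_minus_commute simp flip: norm_eq)
qed

end

text \<open>Reduces every invariance claim below to the elements
  \<open>act (ip y w) y\<close>.\<close>

lemma image_subset_of_closure:
  assumes "bounded_linear T" "closed Z" "y \<in> closure D" "T ` D \<subseteq> Z"
  shows "T y \<in> Z"
  using image_closure_subset[of D T Z] assms bounded_linear.continuous_on[OF assms(1) continuous_on_id]
  by blast


section \<open>Invariance of subbimodules\<close>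

locale compatible_subbimodule =
  X: hilbert_bimodule UNIV UNIV UNIV act ip \<phi> + Y: hilbert_bimodule J I Y act ip \<phi>
  for act :: "'a::cstar_algebra \<Rightarrow> 'x::complex_normed_vector \<Rightarrow> 'x"
    and ip :: "'x \<Rightarrow> 'x \<Rightarrow> 'a"
    and \<phi> :: "'b::cstar_algebra \<Rightarrow> 'x \<Rightarrow> 'x"
    and I J Y +
  assumes norm_X: "norm x = hm_norm ip x"
    and faithful_X: "faithful_compact_right_action UNIV UNIV UNIV act ip \<phi>"
    and faithful_Y: "faithful_compact_right_action J I Y act ip \<phi>"
    and ideal_I: "closed_ideal I"
    and essential_J: "essential_ideal J"
begin

sublocale Y: normed_left_hilbert_module I Y act ip
  by unfold_locales (simp_all add: norm_X ideal_I)

lemma \<phi>_closed: "\<lbrakk>j \<in> J; y \<in> Y\<rbrakk> \<Longrightarrow> \<phi> j y \<in> Y"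
  using Y.\<phi>_adjointable[of j] by (auto simp: adjointable_ops_def PiE_iff)

lemma ideal_J: "j \<in> J \<Longrightarrow> j * b \<in> J \<and> b * j \<in> J"
  using essential_J by (auto simp: essential_ideal_def closed_ideal_def)

lemma elementary_op_X:
  obtains b where "\<And>z. \<phi> b z = act (ip z x) y"
proof -
  have "(\<lambda>z\<in>UNIV. act (ip z x) y) \<in> (\<lambda>b. restrict (\<phi> b) UNIV) ` UNIV"
    using X.elementary_op_compact[of x y] faithful_X
    by (simp add: faithful_compact_right_action_def bij_betw_def)
  then show ?thesis using that by (auto simp: fun_eq_iff)
qed

text \<open>The point is that the formula for \<open>\<phi> j\<close> holds on the whole space, not
  only on \<open>Y\<close>: faithfulness on \<open>Y\<close> supplies \<open>j\<close>, the action
  on the whole space supplies \<open>b\<close>, and essentiality of \<open>J\<close> identifies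
  them.\<close>

lemma elementary_op_Y:
  assumes "x \<in> Y" "y \<in> Y"
  obtains j where "j \<in> J" "\<And>z. \<phi> j z = act (ip z x) y"
proof -
  have "(\<lambda>z\<in>Y. act (ip z x) y) \<in> (\<lambda>b. restrict (\<phi> b) Y) ` J"
    using Y.elementary_op_compact[of x y] assms faithful_Y
    by (simp add: faithful_compact_right_action_def bij_betw_def)
  then obtain j where j: "j \<in> J" "\<And>z. z \<in> Y \<Longrightarrow> \<phi> j z = act (ip z x) y"
    by (auto simp: fun_eq_iff) metis
  obtain b where b: "\<And>z. \<phi> b z = act (ip z x) y"
    using elementary_op_X by blast
  have "b = j"
  proof (rule essential_ideal_cancel[OF essential_J])
    fix k assume k: "k \<in> J"
    have "\<phi> (k * b) z = \<phi> (k * j) z" if "z \<in> Y" for z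
      \<comment> \<open>Since \<open>\<phi> (k * b) z = \<phi> b (\<phi> k z)\<close> and
        \<open>\<phi> k z\<close> lies in \<open>Y\<close>, the formulas for \<open>b\<close> and
        \<open>j\<close> agree there.\<close>
      using that k b j by (simp add: X.\<phi>_mult \<phi>_closed)
    then have "restrict (\<phi> (k * b)) Y = restrict (\<phi> (k * j)) Y"
      by (auto simp: fun_eq_iff)
    moreover have "inj_on (\<lambda>b. restrict (\<phi> b) Y) J"
      using faithful_Y by (simp add: faithful_compact_right_action_def bij_betw_def)
    ultimately show "k * b = k * j"
      using k ideal_J by (auto dest: inj_onD)
  qed
  with b j(1) that show ?thesis by blast
qed

text \<open>On the approximating elements, \<open>a\<close> is absorbed into the coefficient:
  \<open>a * ip y w\<close> is in the ideal \<open>I\<close>.\<close>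

lemma act_A_closed:
  assumes y: "y \<in> Y"
  shows "act a y \<in> Y"
proof (rule image_subset_of_closure[OF _ Y.closed_carrier Y.mem_closure_elementary_ops[OF y]])
  show "bounded_linear (act a)"
  proof (rule bounded_linear_intro[where K = "norm a"])
    show "act a (r *\<^sub>R x) = r *\<^sub>R act a x" for r x
      using X.act_scaleC_right[of a x "complex_of_real r"] by (simp add: scaleC_of_real)
    show "norm (act a x) \<le> norm x * norm a" for x
      using X.norm_act_le[of a x] by (simp add: norm_X mult.commute)
  qed (simp add: X.act_add_right)
  show "act a ` {act (ip y w) y | w. w \<in> Y} \<subseteq> Y"
  proof clarify
    fix w assume w: "w \<in> Y"
    have "a * ip y w \<in> I" using ideal_I y w by (simp add: Y.ip_closed closed_ideal_def)
    then show "act a (act (ip y w) y) \<in> Y"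
      using y by (simp add: Y.act_closed flip: X.act_mult)
  qed
qed

lemma right_module_op_invariant:
  assumes T: "T \<in> bounded_right_module_ops \<phi>" and y: "y \<in> Y"
  shows "T y \<in> Y"
proof (rule image_subset_of_closure[OF _ Y.closed_carrier Y.mem_closure_elementary_ops[OF y]])
  show "bounded_linear T"
    using T by (simp add: bounded_right_module_ops_def bounded_clinear_def)
  show "T ` {act (ip y w) y | w. w \<in> Y} \<subseteq> Y"
  proof clarify
    fix w assume w: "w \<in> Y"
    obtain j where j: "j \<in> J" "\<And>z. \<phi> j z = act (ip z w) y"
      using elementary_op_Y[OF w y] by blast
    \<comment> \<open>The formula for \<open>\<phi> j\<close> is evaluated at \<open>T y\<close>,
      not yet known to lie in \<open>Y\<close>; the resulting coefficient \<open>ip (T y) w\<close>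
      is only known to be in the full algebra, hence the appeal to
      \<open>act_A_closed\<close>.\<close>
    have "T (act (ip y w) y) = \<phi> j (T y)"
      using T by (simp add: bounded_right_module_ops_def flip: j(2))
    also have "\<dots> = act (ip (T y) w) y" by (rule j)
    finally show "T (act (ip y w) y) \<in> Y" using act_A_closed[OF y] by simp
  qed
qed

lemma left_module_op_invariant:
  assumes T: "T \<in> bounded_left_module_ops act" and y: "y \<in> Y"
  shows "T y \<in> Y"
proof (rule image_subset_of_closure[OF _ Y.closed_carrier Y.mem_closure_elementary_ops[OF y]])
  show lin: "bounded_linear T"
    using T by (simp add: bounded_left_module_ops_def bounded_clinear_def)
  show "T ` {act (ip y w) y | w. w \<in> Y} \<subseteq> Y"
  proof clarify
    fix w assume w: "w \<in> Y"
    obtain j where j: "j \<in> J" "\<And>z. \<phi> j z = act (ip z w) y"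
      using elementary_op_Y[OF w y] by blast
    \<comment> \<open>A second approximation follows, now of \<open>x\<close>. The factor
      \<open>j\<close> recorded in \<open>x\<close> is what later forces the acting element into
      \<open>J\<close>.\<close>
    define x where "x = \<phi> j y"
    have x: "x \<in> Y" unfolding x_def by (rule \<phi>_closed[OF j(1) y])
    have "T x \<in> Y"
    proof (rule image_subset_of_closure[OF lin Y.closed_carrier Y.mem_closure_elementary_ops[OF x]])
      show "T ` {act (ip x v) x | v. v \<in> Y} \<subseteq> Y"
      proof clarify
        fix v
        obtain b where b: "\<And>z. \<phi> b z = act (ip z v) (T x)"
          using elementary_op_X by blast
        \<comment> \<open>As \<open>T x\<close> is not yet known to lie in \<open>Y\<close>,
          \<open>b\<close> is only an element of the full algebra; composition reverses the order of
          products, and \<open>j * b\<close> is in \<open>J\<close>.\<close>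
        have "T (act (ip x v) x) = \<phi> b (\<phi> j y)"
          using T by (simp add: bounded_left_module_ops_def b x_def)
        also have "\<dots> = \<phi> (j * b) y" by (simp add: X.\<phi>_mult)
        finally show "T (act (ip x v) x) \<in> Y" by (simp add: \<phi>_closed ideal_J j y)
      qed
    qed
    then show "T (act (ip y w) y) \<in> Y" by (simp add: x_def j)
  qed
qed

end

theorem theorem2p1:
  fixes act :: "'a::cstar_algebra \<Rightarrow> 'x::complex_normed_vector \<Rightarrow> 'x"
    and ip :: "'x \<Rightarrow> 'x \<Rightarrow> 'a"
    and \<phi> :: "'b::cstar_algebra \<Rightarrow> 'x \<Rightarrow> 'x"
    and I :: "'a set" and J :: "'b set"
  assumes morita: "strongly_morita_equivalent TYPE('a) TYPE('b) TYPE('e::complex_vector)"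
    and bimodule: "hilbert_bimodule UNIV UNIV UNIV act ip \<phi>"
    and norm_X: "\<And>x. norm x = hm_norm ip x"
    and faithful: "faithful_compact_right_action UNIV UNIV UNIV act ip \<phi>"
    and I: "essential_ideal I"
    and J: "essential_ideal J"
  shows "(\<forall>T \<in> bounded_left_module_ops act \<union> bounded_right_module_ops \<phi>.
            \<forall>Y \<in> compatible_subbimodules J I act ip \<phi>. closed Y \<longrightarrow> T ` Y \<subseteq> Y) \<and>
         bounded_left_module_ops act \<union> bounded_right_module_ops \<phi>
           \<subseteq> preservers (compatible_subbimodules J I act ip \<phi>)"
proof -
  have invariant: "T ` Y \<subseteq> Y"
    if T: "T \<in> bounded_left_module_ops act \<union> bounded_right_module_ops \<phi>"
      and Y: "Y \<in> compatible_subbimodules J I act ip \<phi>" for T Y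
  proof -
    interpret compatible_subbimodule act ip \<phi> I J Y
      using Y bimodule norm_X faithful I J
      by (auto simp: compatible_subbimodule_def compatible_subbimodule_axioms_def
          compatible_subbimodules_def essential_ideal_def)
    show ?thesis using T left_module_op_invariant right_module_op_invariant by blast
  qed
  moreover have "bounded_clinear T"
    if "T \<in> bounded_left_module_ops act \<union> bounded_right_module_ops \<phi>" for T
    using that by (auto simp: bounded_left_module_ops_def bounded_right_module_ops_def)
  ultimately show ?thesis unfolding preservers_def by blast
qed

end
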